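(* Let $E$ be a separable Banach space and let $T=\{T_t\}_{t\in\mathbb{R}^+}$ be a semigroup of linear operators on $C_b(E)$. Then $T$ is a $C_0$-sequentially equicontinuous semigroup in $(C_b(E),\tau_{\mathcal{M}})$ if and only if it is a $C_0$-sequentially equicontinuous semigroup in $(C_b(E),\tau_{\mathcal{K}})$; likewise, $T$ is a $C_0$-sequentially locally equicontinuous semigroup in $(C_b(E),\tau_{\mathcal{M}})$ if and only if it is a $C_0$-sequentially locally equicontinuous semigroup in $(C_b(E),\tau_{\mathcal{K}})$.
   Context: $\mathbb{R}^+=[0,+\infty)$; $C_b(E)$ is the space of bounded continuous real-valued functions on $E$; $[f]_K=\sup_{x\in K}|f(x)|$. $\mathbf{ca}(E)$ is the space of countably additive finite signed Borel measures on $E$. $\tau_{\mathcal{K}}$ is the locally convex topology on $C_b(E)$ generated by the seminorms $p_{K,\mu}(f)=[f]_K+\left|\int_Ef\,d\mu\right|$, with $K$ ranging over the non-empty compact subsets of $E$ and $\mu$ over $\mathbf{ca}(E)$. The mixed topology $\tau_{\mathcal{M}}$ is the locally convex topology on $C_b(E)$ generated by the seminorms $p_{\mathbf{K},\mathbf{a}}(f)=\sup_{n\in\mathbb{N}}\{a_n[f]_{K_n}\}$, where $\mathbf{K}=\{K_n\}_{n\in\mathbb{N}}$ ranges over sequences of (non-empty) compact subsets of $E$ and $\mathbf{a}=\{a_n\}_{n\in\mathbb{N}}$ over sequences of strictly positive reals converging to $0$. A family $\{f_\iota\}_{\iota\in\mathcal{I}}$ of maps from a topological vector space $Z$ to itself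 is sequentially equicontinuous if for every $z_n\to z$ in $Z$ and every neighborhood $U$ of $0$ there is $\overline n$ with $f_\iota(z_n)\in f_\iota(z)+U$ for all $\iota\in\mathcal{I}$, $n\ge\overline n$. A family of linear operators $\{T_t\}_{t\in\mathbb{R}^+}$ on a Hausdorff locally convex space $Z$ is a $C_0$-sequentially equicontinuous (resp. $C_0$-sequentially locally equicontinuous) semigroup if $T_0=I$, $T_{t+s}=T_tT_s$ for all $t,s\ge 0$, $\lim_{t\to0^+}T_tz=z$ for all $z\in Z$, and $\{T_t\}_{t\in\mathbb{R}^+}$ is sequentially equicontinuous (resp. $\{T_t\}_{t\in[0,R]}$ is sequentially equicontinuous for every $R>0$). *)

theory Defs
  imports "HOL-Analysis.Analysis"
begin

section \<open>Finite signed Borel measures\<close>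

text \<open>A finite signed Borel measure is a real-valued set function; its values outside
  \<open>sets borel\<close> are irrelevant. Taking all \<open>A n\<close> empty forces \<open>\<mu> {} = 0\<close>.\<close>

definition ca :: "('a::topological_space set \<Rightarrow> real) set" where
  "ca = {\<mu>. \<forall>A. range A \<subseteq> sets borel \<longrightarrow> disjoint_family A \<longrightarrow>
                (\<lambda>n. \<mu> (A n)) sums \<mu> (\<Union>n::nat. A n)}"

text \<open>The Jordan decomposition: \<open>\<mu>\<^sup>+(A) = sup {\<mu>(B) | B \<subseteq> A Borel}\<close> and \<open>\<mu>\<^sup>- = (-\<mu>)\<^sup>+\<close>.
  The supremum is at least \<open>\<mu> {} = 0\<close>, and finite because a finite signed measure
  is bounded.\<close>

definition pos_part :: "('a::topological_space set \<Rightarrow> real) \<Rightarrow> 'a measure" where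
  "pos_part \<mu> = measure_of UNIV (sets borel)
     (\<lambda>A. ennreal (SUP B \<in> {B \<in> sets borel. B \<subseteq> A}. \<mu> B))"

definition neg_part :: "('a::topological_space set \<Rightarrow> real) \<Rightarrow> 'a measure" where
  "neg_part \<mu> = pos_part (\<lambda>A. - \<mu> A)"

definition signed_integral :: "('a::topological_space set \<Rightarrow> real) \<Rightarrow> ('a \<Rightarrow> real) \<Rightarrow> real" where
  "signed_integral \<mu> f = (\<integral>x. f x \<partial>pos_part \<mu>) - (\<integral>x. f x \<partial>neg_part \<mu>)"


section \<open>Locally convex topologies on the space of bounded continuous functions\<close>

definition seminorm_topology :: "('z::real_vector \<Rightarrow> real) set \<Rightarrow> 'z topology" where
  "seminorm_topology P = topology_generated_by {{y. p (y - x) < e} |p x e. p \<in> P \<and> e > 0}"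

definition sup_seminorm :: "'a::topological_space set \<Rightarrow> ('a \<Rightarrow>\<^sub>C real) \<Rightarrow> real" where
  "sup_seminorm K f = (SUP x\<in>K. \<bar>apply_bcontfun f x\<bar>)"

definition tau_K :: "('a::topological_space \<Rightarrow>\<^sub>C real) topology" where
  "tau_K = seminorm_topology
     {(\<lambda>f. sup_seminorm K f + \<bar>signed_integral \<mu> (apply_bcontfun f)\<bar>) |K \<mu>.
        compact K \<and> K \<noteq> {} \<and> \<mu> \<in> ca}"

definition tau_M :: "('a::topological_space \<Rightarrow>\<^sub>C real) topology" where
  "tau_M = seminorm_topology
     {(\<lambda>f. SUP n. a n * sup_seminorm (K n) f) |(K :: nat \<Rightarrow> 'a set) (a :: nat \<Rightarrow> real).
        (\<forall>n. compact (K n) \<and> K n \<noteq> {}) \<and> (\<forall>n. a n > 0) \<and> a \<longlonglongrightarrow> 0}"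


section \<open>Sequentially equicontinuous semigroups\<close>

text \<open>Throughout, \<open>X\<close> is the vector space topology under consideration on the real vector
  space \<open>'z\<close>; it is in general unrelated to any type class topology on \<open>'z\<close>.
  Semigroups are indexed by \<open>real\<close>, but only their values on \<open>{0..}\<close> matter.\<close>

definition seq_equicontinuous ::
    "'z::real_vector topology \<Rightarrow> 'i set \<Rightarrow> ('i \<Rightarrow> 'z \<Rightarrow> 'z) \<Rightarrow> bool" where
  "seq_equicontinuous X I f \<longleftrightarrow>
     (\<forall>z l. limitin X z l sequentially \<longrightarrow>
       (\<forall>U. (\<exists>V. openin X V \<and> 0 \<in> V \<and> V \<subseteq> U) \<longrightarrow>
         (\<exists>N::nat. \<forall>i\<in>I. \<forall>n\<ge>N. f i (z n) \<in> (\<lambda>u. f i l + u) ` U)))"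

definition linear_semigroup :: "(real \<Rightarrow> 'z::real_vector \<Rightarrow> 'z) \<Rightarrow> bool" where
  "linear_semigroup T \<longleftrightarrow>
     (\<forall>t\<ge>0. linear (T t)) \<and> T 0 = id \<and> (\<forall>t\<ge>0. \<forall>s\<ge>0. T (t + s) = T t \<circ> T s)"

definition C0_seq_equicontinuous_semigroup ::
    "'z::real_vector topology \<Rightarrow> (real \<Rightarrow> 'z \<Rightarrow> 'z) \<Rightarrow> bool" where
  "C0_seq_equicontinuous_semigroup X T \<longleftrightarrow>
     linear_semigroup T \<and>
     (\<forall>z. limitin X (\<lambda>t. T t z) z (at_right 0)) \<and>
     seq_equicontinuous X {0..} T"

definition C0_seq_locally_equicontinuous_semigroup ::
    "'z::real_vector topology \<Rightarrow> (real \<Rightarrow> 'z \<Rightarrow> 'z) \<Rightarrow> bool" where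
  "C0_seq_locally_equicontinuous_semigroup X T \<longleftrightarrow>
     linear_semigroup T \<and>
     (\<forall>z. limitin X (\<lambda>t. T t z) z (at_right 0)) \<and>
     (\<forall>R>0. seq_equicontinuous X {0..R} T)"

end

theory Submission
  imports Defs
begin

text \<open>
  Both notions of semigroup are conditions on convergent sequences: sequential equicontinuity is
  so by definition, and the filter of right neighbourhoods of \<open>0\<close> has a countable base, so strong
  continuity at \<open>0\<close> is convergence along all sequences \<open>t\<^sub>n \<down> 0\<close>. Two topologies with the same
  convergent sequences therefore have the same semigroups
  (\<open>same_convergent_sequences_imp_same_semigroups\<close>), and it remains to identify the convergent
  sequences of the two topologies. In both, \<open>f\<^sub>n\<close> converges to \<open>l\<close> if and only if \<open>g\<^sub>n = f\<^sub>n - l\<close>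
  is bounded in the supremum norm and tends to \<open>0\<close> uniformly on every compact set
  (\<open>bounded_compact_null\<close>).

  For the mixed topology (\<open>limitin_tau_M_sequentially\<close>), boundedness makes all terms
  \<open>a\<^sub>n [g\<^sub>m]\<close> with large \<open>n\<close> small at once, since \<open>a\<^sub>n\<close> tends to \<open>0\<close>, and finitely many compact
  sets remain; conversely, an unbounded sequence is detected by a seminorm that is built from
  singletons.

  For the topology generated by compact sets and finite signed measures
  (\<open>limitin_tau_K_sequentially\<close>), a bounded sequence that tends to \<open>0\<close> on compact sets tends to
  \<open>0\<close> pointwise, so its integrals tend to \<open>0\<close> by dominated convergence. Conversely, the
  integrals of a null sequence against each fixed measure are bounded, and the uniform
  boundedness principle makes the norms bounded. Only the measures \<open>\<Sum>\<^sub>k c\<^sub>k \<delta>(x\<^sub>k)\<close> with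
  nonnegative weights are needed for this, which permits a direct gliding hump argument
  (\<open>bounded_of_discrete_integrals_bounded\<close>) and leaves no Jordan decomposition to compute
  beyond that of a positive measure.
\<close>

section \<open>Topologies with the same convergent sequences\<close>

lemma limitin_at_right_iff_sequentially:
  fixes a :: real
  shows "limitin X f l (at_right a) \<longleftrightarrow>
    (\<forall>s. (\<forall>n. a < s n) \<longrightarrow> s \<longlonglongrightarrow> a \<longrightarrow> limitin X (\<lambda>n. f (s n)) l sequentially)"
    (is "?L \<longleftrightarrow> ?R")
proof
  assume L: ?L
  show ?R
  proof (intro allI impI)
    fix s :: "nat \<Rightarrow> real" assume s: "\<forall>n. a < s n" "s \<longlonglongrightarrow> a"
    have "filterlim s (at_right a) sequentially"
      using s by (auto simp: filterlim_at less_imp_neq[symmetric])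
    then show "limitin X (\<lambda>n. f (s n)) l sequentially"
      using L unfolding limitin_def by (auto simp: filterlim_iff)
  qed
next
  assume R: ?R
  have "(\<lambda>n. a + inverse (real (Suc n))) \<longlonglongrightarrow> a"
    using tendsto_add[OF tendsto_const LIMSEQ_inverse_real_of_nat, of a] by simp
  moreover have "\<forall>n. a < a + inverse (real (Suc n))"
    by simp
  ultimately have "limitin X (\<lambda>n. f (a + inverse (real (Suc n)))) l sequentially"
    using R[rule_format, of "\<lambda>n. a + inverse (real (Suc n))"] by blast
  then have l: "l \<in> topspace X"
    by (rule limitin_topspace)
  have "eventually (\<lambda>t. f t \<in> U) (at_right a)" if "openin X U" "l \<in> U" for U
    by (rule sequentially_imp_eventually_at_right[of a "a + 1"])
       (use R that in \<open>auto dest: limitinD\<close>)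
  with l show ?L
    unfolding limitin_def by blast
qed

text \<open>Uniformity in the index can be tested along one choice of indices at a time: if it fails
  for a neighbourhood, picking an offending index at every offending \<open>n\<close> produces a sequence
  that leaves this neighbourhood infinitely often.\<close>

lemma seq_equicontinuous_iff_sequentially:
  assumes "0 \<in> topspace X"
  shows "seq_equicontinuous X I f \<longleftrightarrow>
    (\<forall>z l i. limitin X z l sequentially \<longrightarrow> (\<forall>n. i n \<in> I) \<longrightarrow>
       limitin X (\<lambda>n::nat. f (i n) (z n) - f (i n) l) 0 sequentially)"
    (is "?L \<longleftrightarrow> ?R")
proof
  assume L: ?L
  show ?R
  proof (intro allI impI)
    fix z l and i :: "nat \<Rightarrow> 'b"
    assume z: "limitin X z l sequentially" and i: "\<forall>n. i n \<in> I"
    have "eventually (\<lambda>n. f (i n) (z n) - f (i n) l \<in> U) sequentially"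
      if U: "openin X U" "0 \<in> U" for U
    proof -
      have "\<exists>V. openin X V \<and> 0 \<in> V \<and> V \<subseteq> U"
        using U by blast
      then obtain N where N: "\<forall>j\<in>I. \<forall>n\<ge>N. f j (z n) \<in> (\<lambda>u. f j l + u) ` U"
        using L[unfolded seq_equicontinuous_def, rule_format, OF z] by blast
      have "f (i n) (z n) - f (i n) l \<in> U" if "n \<ge> N" for n
      proof -
        have "f (i n) (z n) \<in> (\<lambda>u. f (i n) l + u) ` U"
          using N i that by blast
        then show ?thesis
          by auto
      qed
      then show ?thesis
        unfolding eventually_sequentially by blast
    qed
    then show "limitin X (\<lambda>n. f (i n) (z n) - f (i n) l) 0 sequentially"
      using assms unfolding limitin_def by blast
  qed
next
  assume R: ?R
  show ?L
    unfolding seq_equicontinuous_def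
  proof (intro allI impI)
    fix z :: "nat \<Rightarrow> 'a" and l U
    assume z: "limitin X z l sequentially"
      and "\<exists>V. openin X V \<and> 0 \<in> V \<and> V \<subseteq> U"
    then obtain V where V: "openin X V" "0 \<in> V" "V \<subseteq> U"
      by blast
    show "\<exists>N::nat. \<forall>j\<in>I. \<forall>n\<ge>N. f j (z n) \<in> (\<lambda>u. f j l + u) ` U"
    proof (cases "I = {}")
      case False
      \<comment> \<open>An index that misses \<open>V\<close> at time \<open>n\<close> if there is one, and any index otherwise.\<close>
      have "\<exists>j\<in>I. f j (z n) - f j l \<in> V \<longrightarrow> (\<forall>j\<in>I. f j (z n) - f j l \<in> V)" for n
        using False by blast
      then have "\<exists>i. \<forall>n. i n \<in> I \<and>
          (f (i n) (z n) - f (i n) l \<in> V \<longrightarrow> (\<forall>j\<in>I. f j (z n) - f j l \<in> V))"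
        by (intro choice) blast
      then obtain i where i: "\<And>n. i n \<in> I"
        and worst: "\<And>n j. j \<in> I \<Longrightarrow> f (i n) (z n) - f (i n) l \<in> V \<Longrightarrow> f j (z n) - f j l \<in> V"
        by blast
      have "limitin X (\<lambda>n. f (i n) (z n) - f (i n) l) 0 sequentially"
        using R z i by blast
      from limitinD[OF this V(1,2)]
      obtain N where N: "\<And>n. n \<ge> N \<Longrightarrow> f (i n) (z n) - f (i n) l \<in> V"
        unfolding eventually_sequentially by blast
      then have "f j (z n) - f j l \<in> U" if "j \<in> I" "n \<ge> N" for j n
        using worst[OF that(1) N[OF that(2)]] V(3) by blast
      then have "f j (z n) \<in> (\<lambda>u. f j l + u) ` U" if "j \<in> I" "n \<ge> N" for j n
        using that by (intro image_eqI[where x = "f j (z n) - f j l"]) auto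
      then show ?thesis
        by blast
    qed simp
  qed
qed

lemma same_convergent_sequences_imp_same_semigroups:
  assumes "0 \<in> topspace X" "0 \<in> topspace Y"
    and "\<And>z l. limitin X z l sequentially \<longleftrightarrow> limitin Y z l sequentially"
  shows "C0_seq_equicontinuous_semigroup X T \<longleftrightarrow> C0_seq_equicontinuous_semigroup Y T"
    and "C0_seq_locally_equicontinuous_semigroup X T \<longleftrightarrow>
         C0_seq_locally_equicontinuous_semigroup Y T"
proof -
  have "seq_equicontinuous X I T \<longleftrightarrow> seq_equicontinuous Y I T" for I
    using assms by (simp add: seq_equicontinuous_iff_sequentially)
  moreover have "limitin X (\<lambda>t. T t z) z (at_right 0) \<longleftrightarrow> limitin Y (\<lambda>t. T t z) z (at_right 0)" for z
    using assms(3) by (simp add: limitin_at_right_iff_sequentially)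
  ultimately show "C0_seq_equicontinuous_semigroup X T \<longleftrightarrow> C0_seq_equicontinuous_semigroup Y T"
    and "C0_seq_locally_equicontinuous_semigroup X T \<longleftrightarrow>
         C0_seq_locally_equicontinuous_semigroup Y T"
    by (simp_all add: C0_seq_equicontinuous_semigroup_def
        C0_seq_locally_equicontinuous_semigroup_def)
qed


section \<open>Limits in a topology generated by seminorms\<close>

text \<open>The part of the seminorm axioms by which the subbasic sets that contain \<open>l\<close> can be replaced
  with balls centred at \<open>l\<close>.\<close>

definition nonneg_subadditive :: "('z::real_vector \<Rightarrow> real) \<Rightarrow> bool" where
  "nonneg_subadditive p \<longleftrightarrow> p 0 = 0 \<and> (\<forall>x. 0 \<le> p x) \<and> (\<forall>x y. p (x + y) \<le> p x + p y)"

lemma topspace_seminorm_topology: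
  assumes "\<And>p. p \<in> P \<Longrightarrow> nonneg_subadditive p" "P \<noteq> {}"
  shows "topspace (seminorm_topology P) = UNIV"
proof -
  obtain p where p: "p \<in> P"
    using assms(2) by blast
  have "x \<in> {y. p (y - x) < 1}" for x
    using assms(1)[OF p] by (simp add: nonneg_subadditive_def)
  moreover have "{y. p (y - x) < 1} \<in> {{y. p (y - x) < e} |p x e. p \<in> P \<and> e > 0}" for x
    using p zero_less_one by blast
  ultimately have "x \<in> \<Union> {{y. p (y - x) < e} |p x e. p \<in> P \<and> e > 0}" for x
    by (rule UnionI[rotated])
  then show ?thesis
    unfolding seminorm_topology_def topology_generated_by_topspace by auto
qed

lemma limitin_seminorm_topology:
  assumes P: "\<And>p. p \<in> P \<Longrightarrow> nonneg_subadditive p" "P \<noteq> {}"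
  shows "limitin (seminorm_topology P) f l F \<longleftrightarrow> (\<forall>p\<in>P. ((\<lambda>n. p (f n - l)) \<longlongrightarrow> 0) F)"
    (is "?L \<longleftrightarrow> ?R")
proof
  assume L: ?L
  show ?R
  proof (intro ballI tendstoI)
    fix p and e :: real assume p: "p \<in> P" and e: "e > 0"
    have "openin (seminorm_topology P) {y. p (y - l) < e}"
      unfolding seminorm_topology_def
      by (rule topology_generated_by_Basis) (use p e in blast)
    moreover have "l \<in> {y. p (y - l) < e}"
      using P(1)[OF p] e by (simp add: nonneg_subadditive_def)
    ultimately have "eventually (\<lambda>n. f n \<in> {y. p (y - l) < e}) F"
      by (rule limitinD[OF L])
    then show "eventually (\<lambda>n. dist (p (f n - l)) 0 < e) F"
      using P(1)[OF p] by (simp add: nonneg_subadditive_def)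
  qed
next
  assume R: ?R
  have "eventually (\<lambda>n. f n \<in> U) F" if "openin (seminorm_topology P) U" "l \<in> U" for U
  proof -
    have "generate_topology_on {{y. p (y - x) < e} |p x e. p \<in> P \<and> e > 0} U"
      using that(1) unfolding seminorm_topology_def openin_topology_generated_by_iff .
    then show ?thesis
      using that(2)
    proof induction
      case (Int A B)
      then show ?case by (auto simp: eventually_conj_iff)
    next
      case (UN K)
      then obtain A where A: "A \<in> K" "l \<in> A" by blast
      with UN have "eventually (\<lambda>n. f n \<in> A) F" by blast
      then show ?case
        by (rule eventually_mono) (use A in blast)
    next
      case (Basis A)
      then obtain p x e where A: "A = {y. p (y - x) < e}" and p: "p \<in> P" by blast
      have tri: "p (f n - x) \<le> p (f n - l) + p (l - x)" for n
      proof -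
        have "p ((f n - l) + (l - x)) \<le> p (f n - l) + p (l - x)"
          using P(1)[OF p] unfolding nonneg_subadditive_def by blast
        then show ?thesis by simp
      qed
      have "p (l - x) < e"
        using Basis A by simp
      then have "eventually (\<lambda>n. p (f n - l) < e - p (l - x)) F"
        using R p by (intro order_tendstoD(2)[where y = 0]) auto
      then show ?case
      proof eventually_elim
        case (elim n)
        then show ?case
          using tri[of n] unfolding A by simp
      qed
    qed simp
  qed
  then show ?L
    using topspace_seminorm_topology[OF P] unfolding limitin_def by blast
qed


section \<open>Suprema over compact sets\<close>

lemma bdd_above_abs_bcontfun: "bdd_above ((\<lambda>x. \<bar>apply_bcontfun f x\<bar>) ` K)"
  for f :: "'a::topological_space \<Rightarrow>\<^sub>C real"
  using norm_bounded[of f] by (intro bdd_aboveI2[where M = "norm f"]) simp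

lemma abs_le_sup_seminorm: "x \<in> K \<Longrightarrow> \<bar>apply_bcontfun f x\<bar> \<le> sup_seminorm K f"
  unfolding sup_seminorm_def by (rule cSUP_upper[OF _ bdd_above_abs_bcontfun])

lemma sup_seminorm_le_norm: "K \<noteq> {} \<Longrightarrow> sup_seminorm K f \<le> norm f"
  unfolding sup_seminorm_def using norm_bounded[of f] by (intro cSUP_least) auto

lemma sup_seminorm_nonneg: "K \<noteq> {} \<Longrightarrow> 0 \<le> sup_seminorm K f"
  by (metis abs_ge_zero abs_le_sup_seminorm ex_in_conv order_trans)

lemma sup_seminorm_add_le:
  assumes "K \<noteq> {}"
  shows "sup_seminorm K (f + g) \<le> sup_seminorm K f + sup_seminorm K g"
  unfolding sup_seminorm_def[of K "f + g"]
proof (rule cSUP_least[OF assms])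
  fix x assume "x \<in> K"
  then show "\<bar>apply_bcontfun (f + g) x\<bar> \<le> sup_seminorm K f + sup_seminorm K g"
    using abs_le_sup_seminorm[of x K f] abs_le_sup_seminorm[of x K g] by simp
qed

lemma nonneg_subadditive_sup_seminorm: "K \<noteq> {} \<Longrightarrow> nonneg_subadditive (sup_seminorm K)"
  unfolding nonneg_subadditive_def
  by (simp add: sup_seminorm_nonneg sup_seminorm_add_le) (simp add: sup_seminorm_def)

text \<open>Taken for differences \<open>f n - l\<close>, this describes the convergent sequences of both
  topologies.\<close>

definition bounded_compact_null :: "(nat \<Rightarrow> 'a::topological_space \<Rightarrow>\<^sub>C real) \<Rightarrow> bool" where
  "bounded_compact_null g \<longleftrightarrow> bounded (range g) \<and>
     (\<forall>K. compact K \<longrightarrow> K \<noteq> {} \<longrightarrow> (\<lambda>n. sup_seminorm K (g n)) \<longlonglongrightarrow> 0)"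


section \<open>Null sequences of the mixed topology\<close>

lemma bdd_above_weighted_sup_seminorm:
  fixes a :: "nat \<Rightarrow> real"
  assumes K: "\<And>n. K n \<noteq> {}" and a: "\<And>n. a n > 0" "a \<longlonglongrightarrow> 0"
  shows "bdd_above (range (\<lambda>n. a n * sup_seminorm (K n) f))"
proof -
  obtain A where A: "\<And>n. norm (a n) \<le> A"
    using convergent_imp_Bseq[OF convergentI[OF a(2)]] unfolding Bseq_def by blast
  have "a n * sup_seminorm (K n) f \<le> A * norm f" for n
    using A[of n] a(1)[of n] sup_seminorm_le_norm[OF K[of n], of f] sup_seminorm_nonneg[OF K[of n], of f]
    by (intro mult_mono) auto
  then show ?thesis
    by (intro bdd_aboveI2)
qed

lemma weighted_sup_seminorm_upper:
  fixes a :: "nat \<Rightarrow> real"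
  assumes "\<And>n. K n \<noteq> {}" and "\<And>n. a n > 0" "a \<longlonglongrightarrow> 0"
  shows "a n * sup_seminorm (K n) f \<le> (SUP n. a n * sup_seminorm (K n) f)"
  by (rule cSUP_upper[OF _ bdd_above_weighted_sup_seminorm[where K = K and a = a, OF assms]]) simp

lemma nonneg_subadditive_weighted_sup_seminorm:
  fixes a :: "nat \<Rightarrow> real"
  assumes K: "\<And>n. K n \<noteq> {}" and a: "\<And>n. a n > 0" "a \<longlonglongrightarrow> 0"
  shows "nonneg_subadditive (\<lambda>f. SUP n. a n * sup_seminorm (K n) f)"
proof -
  let ?p = "\<lambda>f. SUP n. a n * sup_seminorm (K n) f"
  note K_semi = nonneg_subadditive_sup_seminorm[OF K, unfolded nonneg_subadditive_def]
  note upper = weighted_sup_seminorm_upper[where K = K and a = a, OF assms]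
  have "?p 0 = 0"
    using K_semi by simp
  moreover have "0 \<le> ?p f" for f
  proof -
    have "0 \<le> a 0 * sup_seminorm (K 0) f"
      using K_semi a(1)[of 0] by simp
    then show ?thesis
      using upper[of 0 f] by linarith
  qed
  moreover have "?p (f + g) \<le> ?p f + ?p g" for f g
  proof (rule cSUP_least)
    fix n
    have "a n * sup_seminorm (K n) (f + g) \<le> a n * (sup_seminorm (K n) f + sup_seminorm (K n) g)"
      using K_semi a(1)[of n] by (intro mult_left_mono) auto
    then show "a n * sup_seminorm (K n) (f + g) \<le> ?p f + ?p g"
      using upper[of n f] upper[of n g] by (simp add: distrib_left)
  qed simp
  ultimately show ?thesis
    unfolding nonneg_subadditive_def by blast
qed

lemma bounded_compact_null_imp_weighted_null:
  fixes a :: "nat \<Rightarrow> real"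
  assumes g: "bounded_compact_null g"
    and K: "\<And>n. compact (K n)" "\<And>n. K n \<noteq> {}" and a: "\<And>n. a n > 0" "a \<longlonglongrightarrow> 0"
  shows "(\<lambda>m. SUP n. a n * sup_seminorm (K n) (g m)) \<longlonglongrightarrow> 0"
proof (rule tendstoI)
  fix e :: real assume e: "e > 0"
  let ?p = "\<lambda>f. SUP n. a n * sup_seminorm (K n) f"
  have nonneg: "0 \<le> ?p f" for f
    using nonneg_subadditive_weighted_sup_seminorm[where K = K and a = a, OF K(2) a] unfolding nonneg_subadditive_def
    by blast
  obtain C where C: "C > 0" "\<And>m. norm (g m) \<le> C"
    using g unfolding bounded_compact_null_def bounded_pos by auto
  have "eventually (\<lambda>n. a n < e / (2 * C)) sequentially"
    using e C by (intro order_tendstoD(2)[OF a(2)]) auto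
  then obtain N where N: "\<And>n. n \<ge> N \<Longrightarrow> a n < e / (2 * C)"
    unfolding eventually_sequentially by blast
  have tail: "a n * sup_seminorm (K n) (g m) \<le> e / 2" if "n \<ge> N" for n m
  proof -
    have "a n * sup_seminorm (K n) (g m) \<le> (e / (2 * C)) * C"
      using N[OF that] a(1)[of n] C order_trans[OF sup_seminorm_le_norm[OF K(2)] C(2)]
        sup_seminorm_nonneg[OF K(2)[of n], of "g m"] e
      by (intro mult_mono) auto
    then show ?thesis using C by simp
  qed
  have "eventually (\<lambda>m. \<forall>n\<in>{..<N}. a n * sup_seminorm (K n) (g m) < e / 2) sequentially"
  proof (intro eventually_ball_finite ballI)
    fix n
    have "(\<lambda>m. a n * sup_seminorm (K n) (g m)) \<longlonglongrightarrow> a n * 0"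
      using g K unfolding bounded_compact_null_def by (intro tendsto_mult tendsto_const) auto
    then show "eventually (\<lambda>m. a n * sup_seminorm (K n) (g m) < e / 2) sequentially"
      using e by (intro order_tendstoD(2)[where y = 0]) auto
  qed simp
  then show "eventually (\<lambda>m. dist (?p (g m)) 0 < e) sequentially"
  proof eventually_elim
    case (elim m)
    have "?p (g m) \<le> e / 2"
    proof (rule cSUP_least)
      fix n show "a n * sup_seminorm (K n) (g m) \<le> e / 2"
        using elim tail[of n m] by (cases "n < N") (auto intro: less_imp_le)
    qed simp
    then show ?case
      using e nonneg[of "g m"] by simp
  qed
qed

text \<open>Boundedness is forced by singletons: if \<open>g\<close> were unbounded, the weights \<open>1 / (k + 1)\<close> at
  points where \<open>\<bar>g (m k)\<bar>\<close> exceeds \<open>(k + 1)\<^sup>2\<close> would define a seminorm of the mixed topology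
  that is unbounded along \<open>g\<close>.\<close>

lemma weighted_null_imp_bounded:
  assumes null: "\<And>K a. \<lbrakk>\<And>n. compact (K n); \<And>n. K n \<noteq> {}; \<And>n::nat. a n > 0; a \<longlonglongrightarrow> 0\<rbrakk> \<Longrightarrow>
      (\<lambda>m. SUP n. a n * sup_seminorm (K n) (g m)) \<longlonglongrightarrow> (0::real)"
  shows "bounded (range g)"
proof (rule ccontr)
  assume unbounded: "\<not> bounded (range g)"
  have "\<exists>m x. \<bar>apply_bcontfun (g m) x\<bar> > real (Suc k) * real (Suc k)" for k
  proof (rule ccontr)
    assume "\<not> ?thesis"
    then have "norm (g m) \<le> real (Suc k) * real (Suc k)" for m
      by (intro norm_bound) (auto simp: not_less)
    with unbounded show False
      unfolding bounded_iff by auto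
  qed
  then obtain m x where large: "\<And>k. \<bar>apply_bcontfun (g (m k)) (x k)\<bar> > real (Suc k) * real (Suc k)"
    by metis
  define a where "a k = inverse (real (Suc k))" for k
  have a: "\<And>k. a k > 0" "a \<longlonglongrightarrow> 0"
    unfolding a_def using LIMSEQ_inverse_real_of_nat by auto
  let ?p = "\<lambda>f. SUP k. a k * sup_seminorm {x k} f"
  have "(\<lambda>n. ?p (g n)) \<longlonglongrightarrow> 0"
    by (rule null) (use a in auto)
  from convergent_imp_Bseq[OF convergentI[OF this]]
  obtain C where C: "\<And>n. norm (?p (g n)) \<le> C"
    unfolding Bseq_def by blast
  obtain k where k: "C < real k"
    using reals_Archimedean2 by blast
  have "real (Suc k) \<le> a k * \<bar>apply_bcontfun (g (m k)) (x k)\<bar>"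
    using large[of k] unfolding a_def by (simp add: field_simps)
  also have "\<dots> \<le> a k * sup_seminorm {x k} (g (m k))"
    using a(1)[of k] abs_le_sup_seminorm[of "x k" "{x k}" "g (m k)"] by (intro mult_left_mono) auto
  also have "\<dots> \<le> ?p (g (m k))"
    using a by (intro weighted_sup_seminorm_upper[where K = "\<lambda>k. {x k}"]) auto
  also have "\<dots> \<le> C"
    using C[of "m k"] by simp
  finally show False
    using k by simp
qed

lemma limitin_tau_M_seminorms:
  "limitin tau_M f l F \<longleftrightarrow>
     (\<forall>K a. (\<forall>n. compact (K n) \<and> K n \<noteq> {}) \<longrightarrow> (\<forall>n::nat. a n > 0) \<longrightarrow> a \<longlonglongrightarrow> (0::real) \<longrightarrow>
        ((\<lambda>m. SUP n. a n * sup_seminorm (K n) (f m - l)) \<longlongrightarrow> 0) F)"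
  (is ?lim)
  and topspace_tau_M: "topspace (tau_M :: ('a::topological_space \<Rightarrow>\<^sub>C real) topology) = UNIV"
  for f :: "'i \<Rightarrow> 'a::topological_space \<Rightarrow>\<^sub>C real"
proof -
  let ?P = "{(\<lambda>f. SUP n. a n * sup_seminorm (K n) f) |(K :: nat \<Rightarrow> 'a set) (a :: nat \<Rightarrow> real).
        (\<forall>n. compact (K n) \<and> K n \<noteq> {}) \<and> (\<forall>n. a n > 0) \<and> a \<longlonglongrightarrow> 0}"
  have P: "nonneg_subadditive p" if "p \<in> ?P" for p
    using that nonneg_subadditive_weighted_sup_seminorm by blast
  have "(\<lambda>f. SUP n. inverse (real (Suc n)) * sup_seminorm {undefined} f) \<in> ?P"
    using LIMSEQ_inverse_real_of_nat
    by (intro CollectI exI[where x = "\<lambda>_. {undefined}"] exI[where x = "\<lambda>n. inverse (real (Suc n))"])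
      auto
  then have nonempty: "?P \<noteq> {}"
    by blast
  show ?lim
    unfolding tau_M_def limitin_seminorm_topology[OF P nonempty, simplified] by blast
  show "topspace (tau_M :: ('a \<Rightarrow>\<^sub>C real) topology) = UNIV"
    unfolding tau_M_def by (rule topspace_seminorm_topology[OF P nonempty])
qed

lemma limitin_tau_M_sequentially:
  "limitin tau_M f l sequentially \<longleftrightarrow> bounded_compact_null (\<lambda>n. f n - l)"
proof
  assume lim: "limitin tau_M f l sequentially"
  have null: "(\<lambda>m. SUP n. a n * sup_seminorm (K n) (f m - l)) \<longlonglongrightarrow> 0"
    if "\<And>n. compact (K n)" "\<And>n. K n \<noteq> {}" "\<And>n::nat. a n > 0" "a \<longlonglongrightarrow> (0::real)" for K a
    using lim that unfolding limitin_tau_M_seminorms by blast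
  have "(\<lambda>m. sup_seminorm K (f m - l)) \<longlonglongrightarrow> 0" if K: "compact K" "K \<noteq> {}" for K
  proof -
    let ?a = "\<lambda>n. inverse (real (Suc n))"
    \<comment> \<open>As \<open>?a 0 = 1\<close>, the seminorm with all compact sets equal to \<open>K\<close> dominates \<open>[_]\<^sub>K\<close>.\<close>
    have "(\<lambda>m. SUP n. ?a n * sup_seminorm K (f m - l)) \<longlonglongrightarrow> 0"
      using K LIMSEQ_inverse_real_of_nat by (intro null) auto
    then show ?thesis
    proof (rule tendsto_sandwich[rotated -1])
      show "eventually (\<lambda>m. sup_seminorm K (f m - l) \<le>
          (SUP n. ?a n * sup_seminorm K (f m - l))) sequentially"
        using K LIMSEQ_inverse_real_of_nat
          weighted_sup_seminorm_upper[where K = "\<lambda>_. K" and a = ?a and n = 0]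
        by auto
    qed (use sup_seminorm_nonneg[OF K(2)] in auto)
  qed
  moreover have "bounded (range (\<lambda>n. f n - l))"
    by (rule weighted_null_imp_bounded) (rule null)
  ultimately show "bounded_compact_null (\<lambda>n. f n - l)"
    unfolding bounded_compact_null_def by blast
next
  assume "bounded_compact_null (\<lambda>n. f n - l)"
  then show "limitin tau_M f l sequentially"
    unfolding limitin_tau_M_seminorms
    by (intro allI impI bounded_compact_null_imp_weighted_null) auto
qed


section \<open>Integration against finite signed measures\<close>

lemma sets_pos_part [simp, measurable_cong]: "sets (pos_part \<mu>) = sets borel"
  and space_pos_part [simp]: "space (pos_part \<mu>) = UNIV"
  unfolding pos_part_def using sets.sigma_sets_eq[of borel]
  by (simp_all add: sets_measure_of_conv space_measure_of_conv)

text \<open>The construction of a measure from a set function that is not countably additive yields the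
  zero measure; hence the total mass is the real number \<open>SUP B. \<mu> B\<close> or \<open>0\<close>, and it is finite
  whatever \<open>\<mu>\<close> is.\<close>

lemma finite_measure_pos_part: "finite_measure (pos_part \<mu>)"
  by (rule finite_measureI) (auto simp: pos_part_def emeasure_measure_of_conv)

lemma borel_measurable_bcontfun [measurable]:
  "apply_bcontfun f \<in> borel_measurable borel"
  for f :: "'a::topological_space \<Rightarrow>\<^sub>C real"
  by (rule borel_measurable_continuous_onI) simp

lemma integrable_bcontfun:
  fixes f :: "'a::topological_space \<Rightarrow>\<^sub>C real"
  assumes "finite_measure M" and [measurable_cong]: "sets M = sets borel"
  shows "integrable M (apply_bcontfun f)"
  using norm_bounded[of f] finite_measure.integrable_const_bound[OF assms(1), of "apply_bcontfun f" "norm f"]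
  by simp

lemma signed_integral_add:
  "signed_integral \<mu> (apply_bcontfun (f + g)) =
     signed_integral \<mu> (apply_bcontfun f) + signed_integral \<mu> (apply_bcontfun g)"
  unfolding signed_integral_def neg_part_def
  by (simp add: integrable_bcontfun finite_measure_pos_part)

lemma integral_bounded_compact_null:
  fixes g :: "nat \<Rightarrow> 'a::topological_space \<Rightarrow>\<^sub>C real"
  assumes g: "bounded_compact_null g" and M: "finite_measure M" "sets M = sets borel"
  shows "(\<lambda>n. \<integral>x. apply_bcontfun (g n) x \<partial>M) \<longlonglongrightarrow> 0"
proof -
  interpret finite_measure M by fact
  note M(2)[measurable_cong]
  obtain C where C: "\<And>n. norm (g n) \<le> C"
    using g unfolding bounded_compact_null_def bounded_pos by auto
  have "(\<lambda>n. apply_bcontfun (g n) x) \<longlonglongrightarrow> 0" for x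
  proof (rule Lim_null_comparison)
    show "(\<lambda>n. sup_seminorm {x} (g n)) \<longlonglongrightarrow> 0"
      using g unfolding bounded_compact_null_def by simp
  qed (simp add: abs_le_sup_seminorm)
  moreover have "norm (apply_bcontfun (g n) x) \<le> C" for n x
    using norm_bounded[of "g n" x] C[of n] by linarith
  ultimately have "(\<lambda>n. \<integral>x. apply_bcontfun (g n) x \<partial>M) \<longlonglongrightarrow> (\<integral>x. 0 \<partial>M)"
    by (intro integral_dominated_convergence[where w = "\<lambda>_. C"]) auto
  then show ?thesis
    by simp
qed

lemma finite_measure_in_ca:
  assumes "finite_measure M" "sets M = sets borel"
  shows "measure M \<in> ca"
  using finite_measure.finite_measure_UNION[OF assms(1)] assms(2) unfolding ca_def by blast

lemma pos_part_measure:
  fixes M :: "'a::topological_space measure"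
  assumes "finite_measure M" and sets: "sets M = sets borel"
  shows "pos_part (measure M) = M"
proof -
  interpret finite_measure M by fact
  have space: "space M = UNIV"
    using sets_eq_imp_space_eq[OF sets] by simp
  have "(SUP B \<in> {B \<in> sets borel. B \<subseteq> A}. measure M B) = measure M A" if "A \<in> sets borel" for A
    using that sets by (intro cSup_eq_maximum) (auto intro: finite_measure_mono)
  then have "pos_part (measure M) = measure_of UNIV (sets borel) (emeasure M)"
    unfolding pos_part_def using sets.sigma_sets_eq[of "borel :: 'a measure"]
    by (intro measure_of_eq) (auto simp: emeasure_eq_measure)
  also have "\<dots> = M"
    using measure_of_of_measure[of M] sets space by simp
  finally show ?thesis .
qed

lemma neg_part_measure:
  assumes "A \<in> sets borel"
  shows "emeasure (neg_part (measure M)) A = 0"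
proof -
  have "(SUP B \<in> {B \<in> sets borel. B \<subseteq> A}. - measure M B) = 0"
    by (intro cSup_eq_maximum) (auto intro: image_eqI[where x = "{}"])
  then show ?thesis
    unfolding neg_part_def pos_part_def emeasure_measure_of_conv by simp
qed

lemma signed_integral_measure:
  fixes M :: "'a::topological_space measure"
  assumes "finite_measure M" "sets M = sets borel"
  shows "signed_integral (measure M) f = (\<integral>x. f x \<partial>M)"
proof -
  let ?N = "neg_part (measure M)"
  have "emeasure ?N (space ?N) = 0"
    by (rule neg_part_measure) (simp add: neg_part_def)
  then have "AE x in ?N. f x = 0"
    by (intro AE_I[where N = "space ?N"]) auto
  then have "(\<integral>x. f x \<partial>?N) = 0"
    by (rule integral_eq_zero_AE)
  then show ?thesis
    unfolding signed_integral_def by (simp add: pos_part_measure[OF assms])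
qed

text \<open>The measure is \<open>\<Sum>\<^sub>k c\<^sub>k \<delta>(x\<^sub>k)\<close>, obtained as the image under \<open>x\<close> of the measure on the natural
  numbers with weights \<open>c\<close>; points that occur several times in \<open>x\<close> then need no care.\<close>

lemma ex_discrete_measure_integral:
  fixes c :: "nat \<Rightarrow> real" and x :: "nat \<Rightarrow> 'a::topological_space"
  assumes c: "\<And>k. 0 \<le> c k" "summable c"
  obtains \<mu> where "\<mu> \<in> ca"
    and "\<And>f :: 'a \<Rightarrow>\<^sub>C real. (\<lambda>k. c k * apply_bcontfun f (x k)) sums signed_integral \<mu> (apply_bcontfun f)"
proof -
  define D where "D = density (count_space UNIV) (\<lambda>k. ennreal (c k))"
  define M where "M = distr D borel x"
  have [measurable]: "x \<in> measurable D borel"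
    by (simp add: D_def)
  have sets: "sets M = sets borel"
    by (simp add: M_def)
  have "emeasure D (space D) = (\<Sum>k. ennreal (c k))"
    by (simp add: D_def emeasure_density nn_integral_count_space_nat)
  then have D_fin: "finite_measure D"
    using c by (intro finite_measureI) (simp add: suminf_ennreal2)
  then have fin: "finite_measure M"
    unfolding M_def by (rule finite_measure.finite_measure_distr) simp
  have int: "(\<lambda>k. c k * apply_bcontfun f (x k)) sums (\<integral>y. apply_bcontfun f y \<partial>M)"
    for f :: "'a \<Rightarrow>\<^sub>C real"
  proof -
    have "integrable (count_space UNIV) (\<lambda>k. c k * apply_bcontfun f (x k))"
    proof -
      have "integrable D (\<lambda>k. apply_bcontfun f (x k))"
        using integrable_bcontfun[OF fin sets, of f] unfolding M_def
        by (simp add: integrable_distr_eq)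
      then show ?thesis
        unfolding D_def using c by (simp add: integrable_density)
    qed
    from sums_integral_count_space_nat[OF this]
    show ?thesis
      unfolding M_def D_def using c by (simp add: integral_distr integral_density)
  qed
  show thesis
    by (rule that[OF finite_measure_in_ca[OF fin sets]])
       (simp add: signed_integral_measure[OF fin sets] int)
qed


section \<open>Uniform boundedness against discrete measures\<close>

lemma ex_abs_ge_fraction_norm:
  fixes f :: "'a::topological_space \<Rightarrow>\<^sub>C real"
  assumes "r < 1" "0 < norm f"
  shows "\<exists>x. r * norm f \<le> \<bar>apply_bcontfun f x\<bar>"
proof (rule ccontr)
  assume "\<not> ?thesis"
  then have "norm f \<le> r * norm f"
    by (intro norm_bound) (auto simp: not_le less_imp_le)
  with assms show False
    by simp
qed

text \<open>A uniform boundedness principle, by a gliding hump. If \<open>S\<close> is unbounded, take \<open>F k \<in> S\<close> with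
  \<open>4\<^sup>-\<^sup>k \<parallel>F k\<parallel> > 12 (k + 1)\<close> and a point \<open>x k\<close> at which \<open>F k\<close> attains \<open>5/6\<close> of its norm, and
  choose the weights \<open>c k \<in> {0, 4\<^sup>-\<^sup>k}\<close> one after the other such that the sum of the terms up to
  \<open>k\<close> has modulus at least \<open>(5/12) 4\<^sup>-\<^sup>k \<parallel>F k\<parallel>\<close> on \<open>F k\<close>. The later terms contribute at most
  \<open>(1/3) 4\<^sup>-\<^sup>k \<parallel>F k\<parallel>\<close>, and the difference of at least \<open>(1/12) 4\<^sup>-\<^sup>k \<parallel>F k\<parallel> > k + 1\<close> is unbounded in
  \<open>k\<close>.\<close>

lemma bounded_of_discrete_integrals_bounded:
  fixes S :: "('a::topological_space \<Rightarrow>\<^sub>C real) set"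
  assumes bdd: "\<And>(c :: nat \<Rightarrow> real) x. (\<And>k. 0 \<le> c k) \<Longrightarrow> summable c \<Longrightarrow>
      \<exists>B. \<forall>f\<in>S. \<bar>\<Sum>k. c k * apply_bcontfun f (x k)\<bar> \<le> B"
  shows "bounded S"
proof (rule ccontr)
  assume unbounded: "\<not> bounded S"
  define q where "q k = (1/4 :: real) ^ k" for k
  have q_pos: "q k > 0" for k
    by (simp add: q_def)
  have "\<exists>f\<in>S. norm f > 12 * real (Suc k) / q k" for k
    using unbounded unfolding bounded_iff by (metis not_le)
  then obtain F where F: "\<And>k. F k \<in> S" "\<And>k. norm (F k) > 12 * real (Suc k) / q k"
    by metis
  have norm_pos: "norm (F k) > 0" for k
    using F(2)[of k] q_pos[of k] by (smt (verit) divide_pos_pos of_nat_0_less_iff zero_less_Suc)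
  have "\<exists>x. 5/6 * norm (F k) \<le> \<bar>apply_bcontfun (F k) x\<bar>" for k
    by (rule ex_abs_ge_fraction_norm) (use norm_pos in auto)
  then obtain x where x: "\<And>k. 5/6 * norm (F k) \<le> \<bar>apply_bcontfun (F k) (x k)\<bar>"
    by metis
  \<comment> \<open>Of two numbers that differ by \<open>d\<close>, one has modulus at least \<open>\<bar>d\<bar> / 2\<close>; so adding or not
    adding the point mass \<open>q k\<close> at \<open>x k\<close> makes the partial sum large on \<open>F k\<close>.\<close>
  obtain L :: "nat \<Rightarrow> ('a \<Rightarrow>\<^sub>C real) \<Rightarrow> real" where L0: "L 0 = (\<lambda>f. 0)"
    and L_step: "\<And>k. (\<exists>c\<in>{0, q k}. L (Suc k) = (\<lambda>f. L k f + c * apply_bcontfun f (x k))) \<and>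
        q k * \<bar>apply_bcontfun (F k) (x k)\<bar> / 2 \<le> \<bar>L (Suc k) (F k)\<bar>"
  proof -
    have "\<exists>L. \<forall>k. (k = 0 \<longrightarrow> L k = (\<lambda>f. 0)) \<and>
      ((\<exists>c\<in>{0, q k}. L (Suc k) = (\<lambda>f. L k f + c * apply_bcontfun f (x k))) \<and>
        q k * \<bar>apply_bcontfun (F k) (x k)\<bar> / 2 \<le> \<bar>L (Suc k) (F k)\<bar>)"
    proof (rule dependent_nat_choice)
      fix L :: "('a \<Rightarrow>\<^sub>C real) \<Rightarrow> real" and k
      let ?d = "q k * apply_bcontfun (F k) (x k)"
      have abs_d: "\<bar>?d\<bar> = q k * \<bar>apply_bcontfun (F k) (x k)\<bar>"
        using q_pos[of k] by (simp add: abs_mult)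
      show "\<exists>L'. (Suc k = 0 \<longrightarrow> L' = (\<lambda>f. 0)) \<and>
        ((\<exists>c\<in>{0, q k}. L' = (\<lambda>f. L f + c * apply_bcontfun f (x k))) \<and>
        q k * \<bar>apply_bcontfun (F k) (x k)\<bar> / 2 \<le> \<bar>L' (F k)\<bar>)"
      proof (cases "\<bar>?d\<bar> / 2 \<le> \<bar>L (F k)\<bar>")
        case True
        then show ?thesis using abs_d by (intro exI[where x = L]) auto
      next
        case False
        then have "\<bar>?d\<bar> / 2 \<le> \<bar>L (F k) + ?d\<bar>" by linarith
        then show ?thesis
          using abs_d by (intro exI[where x = "\<lambda>f. L f + q k * apply_bcontfun f (x k)"]) auto
      qed
    qed simp
    then show ?thesis using that by blast
  qed
  obtain c where c_cases: "\<And>k. c k = 0 \<or> c k = q k"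
    and c: "\<And>k. L (Suc k) = (\<lambda>f. L k f + c k * apply_bcontfun f (x k))"
    using L_step by (metis insert_iff singletonD)
  have L_sum: "L k f = (\<Sum>j<k. c j * apply_bcontfun f (x j))" for k f
    by (induction k) (simp_all add: L0 c)
  have c_nonneg: "0 \<le> c k" and c_le: "c k \<le> q k" for k
    using c_cases[of k] q_pos[of k] by auto
  have q_sums: "(\<lambda>j. q (j + k)) sums (4/3 * q k)" for k
    using sums_mult2[OF geometric_sums[of "1/4 :: real"], of "q k"]
    by (simp add: q_def power_add)
  have c_summable: "summable c"
    by (rule summable_comparison_test'[where g = q and N = 0])
       (use q_sums[of 0] c_nonneg c_le in \<open>auto simp: sums_iff\<close>)
  obtain B where B: "\<And>f. f \<in> S \<Longrightarrow> \<bar>\<Sum>k. c k * apply_bcontfun f (x k)\<bar> \<le> B"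
    using bdd[OF c_nonneg c_summable, of x] by blast
  have lower: "real (Suc k) \<le> \<bar>\<Sum>j. c j * apply_bcontfun (F k) (x j)\<bar>" for k
  proof -
    let ?t = "\<lambda>j. c j * apply_bcontfun (F k) (x j)"
    have t_le: "norm (?t j) \<le> q j * norm (F k)" for j
      using norm_bounded[of "F k" "x j"] c_nonneg[of j] c_le[of j] q_pos[of j]
      by (auto simp: abs_mult intro!: mult_mono)
    have q_norm_sums: "(\<lambda>j. q (j + i) * norm (F k)) sums (4/3 * q i * norm (F k))" for i
      by (intro sums_mult2 q_sums)
    have t_summable: "summable ?t"
      by (rule summable_comparison_test'[where g = "\<lambda>j. q j * norm (F k)" and N = 0])
         (use t_le q_norm_sums[of 0] in \<open>auto simp: sums_iff\<close>)
    have tail: "\<bar>\<Sum>j. ?t (j + Suc k)\<bar> \<le> q k * norm (F k) / 3"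
    proof -
      have bound_sums: "(\<lambda>j. q (j + Suc k) * norm (F k)) sums (q k * norm (F k) / 3)"
        using q_norm_sums[of "Suc k"] by (simp add: q_def)
      have "norm (\<Sum>j. ?t (j + Suc k)) \<le> (\<Sum>j. q (j + Suc k) * norm (F k))"
        by (rule norm_suminf_le[OF t_le sums_summable[OF bound_sums]])
      then show ?thesis
        using sums_unique[OF bound_sums] by simp
    qed
    have split: "(\<Sum>j. ?t j) = (\<Sum>j. ?t (j + Suc k)) + L (Suc k) (F k)"
      unfolding L_sum by (rule suminf_split_initial_segment[OF t_summable])
    have "q k * (5/6 * norm (F k)) \<le> q k * \<bar>apply_bcontfun (F k) (x k)\<bar>"
      using x[of k] q_pos[of k] by (intro mult_left_mono) auto
    then have head: "5/12 * (q k * norm (F k)) \<le> \<bar>L (Suc k) (F k)\<bar>"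
      using L_step[of k] by linarith
    have "12 * real (Suc k) < q k * norm (F k)"
      using F(2)[of k] q_pos[of k] by (simp add: field_simps)
    moreover have "r \<le> \<bar>a + b\<bar>" if "5/12 * m \<le> \<bar>b\<bar>" "\<bar>a\<bar> \<le> m / 3" "12 * r < m"
      for a b m r :: real
      using that by linarith
    ultimately show ?thesis
      using head tail unfolding split by blast
  qed
  obtain k where "B < real k"
    using reals_Archimedean2 by blast
  with lower[of k] B[OF F(1)[of k]] show False
    by simp
qed

section \<open>Null sequences of the topology of compact sets and measures\<close>

lemma limitin_tau_K_seminorms:
  "limitin tau_K f l F \<longleftrightarrow>
     (\<forall>K \<mu>. compact K \<longrightarrow> K \<noteq> {} \<longrightarrow> \<mu> \<in> ca \<longrightarrow>
        ((\<lambda>m. sup_seminorm K (f m - l) + \<bar>signed_integral \<mu> (apply_bcontfun (f m - l))\<bar>) \<longlongrightarrow> 0) F)"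
  (is ?lim)
  and topspace_tau_K: "topspace (tau_K :: ('a::topological_space \<Rightarrow>\<^sub>C real) topology) = UNIV"
  for f :: "'i \<Rightarrow> 'a::topological_space \<Rightarrow>\<^sub>C real"
proof -
  let ?P = "{(\<lambda>f. sup_seminorm K f + \<bar>signed_integral \<mu> (apply_bcontfun f)\<bar>) |(K :: 'a set) \<mu>.
        compact K \<and> K \<noteq> {} \<and> \<mu> \<in> ca}"
  have P: "nonneg_subadditive p" if p: "p \<in> ?P" for p
  proof -
    obtain K \<mu> where K: "K \<noteq> {}"
      and p_eq: "p = (\<lambda>f. sup_seminorm K f + \<bar>signed_integral \<mu> (apply_bcontfun f)\<bar>)"
      using p by blast
    have "signed_integral \<mu> (apply_bcontfun 0) = 0"
      by (simp add: signed_integral_def)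
    then show ?thesis
      using nonneg_subadditive_sup_seminorm[OF K]
      unfolding nonneg_subadditive_def p_eq signed_integral_add
      by (smt (verit))
  qed
  have "(\<lambda>_. 0 :: real) \<in> (ca :: ('a set \<Rightarrow> real) set)"
    by (simp add: ca_def)
  then have nonempty: "?P \<noteq> {}"
    using finite_imp_compact[of "{undefined :: 'a}"] by blast
  show ?lim
    unfolding tau_K_def limitin_seminorm_topology[OF P nonempty, simplified] by blast
  show "topspace (tau_K :: ('a \<Rightarrow>\<^sub>C real) topology) = UNIV"
    unfolding tau_K_def by (rule topspace_seminorm_topology[OF P nonempty])
qed

lemma limitin_tau_K_sequentially:
  fixes f :: "nat \<Rightarrow> 'a::topological_space \<Rightarrow>\<^sub>C real"
  shows "limitin tau_K f l sequentially \<longleftrightarrow> bounded_compact_null (\<lambda>n. f n - l)"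
proof
  let ?g = "\<lambda>n. f n - l"
  assume lim: "limitin tau_K f l sequentially"
  have null: "(\<lambda>n. sup_seminorm K (?g n) + \<bar>signed_integral \<mu> (apply_bcontfun (?g n))\<bar>) \<longlonglongrightarrow> 0"
    if "compact K" "K \<noteq> {}" "\<mu> \<in> ca" for K \<mu>
    using lim that unfolding limitin_tau_K_seminorms by blast
  have compact_null: "(\<lambda>n. sup_seminorm K (?g n)) \<longlonglongrightarrow> 0" if K: "compact K" "K \<noteq> {}" for K
  proof (rule tendsto_sandwich[rotated -1])
    show "(\<lambda>n. sup_seminorm K (?g n) + \<bar>signed_integral (\<lambda>_. 0) (apply_bcontfun (?g n))\<bar>) \<longlonglongrightarrow> 0"
      by (rule null) (use K in \<open>auto simp: ca_def\<close>)
  qed (use sup_seminorm_nonneg[OF K(2)] in auto)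
  have "bounded (range ?g)"
  proof (rule bounded_of_discrete_integrals_bounded)
    fix c :: "nat \<Rightarrow> real" and x :: "nat \<Rightarrow> 'a"
    assume "\<And>k. 0 \<le> c k" "summable c"
    then obtain \<mu> where \<mu>: "\<mu> \<in> ca" and integral:
      "\<And>f :: 'a \<Rightarrow>\<^sub>C real. (\<lambda>k. c k * apply_bcontfun f (x k)) sums signed_integral \<mu> (apply_bcontfun f)"
      using ex_discrete_measure_integral by blast
    let ?p = "\<lambda>n. sup_seminorm {undefined} (?g n) + \<bar>signed_integral \<mu> (apply_bcontfun (?g n))\<bar>"
    have "?p \<longlonglongrightarrow> 0"
      using \<mu> by (intro null) auto
    from convergent_imp_Bseq[OF convergentI[OF this]]
    obtain B where B: "\<And>n. norm (?p n) \<le> B"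
      unfolding Bseq_def by blast
    have "\<bar>signed_integral \<mu> (apply_bcontfun (?g n))\<bar> \<le> B" for n
      using B[of n] sup_seminorm_nonneg[of "{undefined}" "?g n"] by simp
    then have "\<bar>\<Sum>k. c k * apply_bcontfun (?g n) (x k)\<bar> \<le> B" for n
      unfolding sums_unique[OF integral, symmetric] .
    then show "\<exists>B. \<forall>h\<in>range ?g. \<bar>\<Sum>k. c k * apply_bcontfun h (x k)\<bar> \<le> B"
      by blast
  qed
  with compact_null show "bounded_compact_null ?g"
    unfolding bounded_compact_null_def by blast
next
  let ?g = "\<lambda>n. f n - l"
  assume g: "bounded_compact_null ?g"
  have "(\<lambda>n. sup_seminorm K (?g n) + \<bar>signed_integral \<mu> (apply_bcontfun (?g n))\<bar>) \<longlonglongrightarrow> 0"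
    if "compact K" "K \<noteq> {}" for K \<mu>
  proof -
    have "(\<lambda>n. sup_seminorm K (?g n)) \<longlonglongrightarrow> 0"
      using g that unfolding bounded_compact_null_def by blast
    moreover have "(\<lambda>n. signed_integral \<mu> (apply_bcontfun (?g n))) \<longlonglongrightarrow> 0 - 0"
      unfolding signed_integral_def neg_part_def
      by (intro tendsto_diff integral_bounded_compact_null[OF g finite_measure_pos_part sets_pos_part])
    ultimately show ?thesis
      by (auto intro!: tendsto_eq_intros)
  qed
  then show "limitin tau_K f l sequentially"
    unfolding limitin_tau_K_seminorms by blast
qed

theorem proposition4p24:
  fixes T :: "real \<Rightarrow> ('a::banach \<Rightarrow>\<^sub>C real) \<Rightarrow> ('a \<Rightarrow>\<^sub>C real)"
  assumes "separable_space (euclidean :: 'a topology)"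
    and "linear_semigroup T"
  shows "(C0_seq_equicontinuous_semigroup tau_M T \<longleftrightarrow>
            C0_seq_equicontinuous_semigroup tau_K T) \<and>
         (C0_seq_locally_equicontinuous_semigroup tau_M T \<longleftrightarrow>
            C0_seq_locally_equicontinuous_semigroup tau_K T)"
proof -
  have "limitin tau_M z l sequentially \<longleftrightarrow> limitin tau_K z l sequentially"
    for z and l :: "'a \<Rightarrow>\<^sub>C real"
    unfolding limitin_tau_M_sequentially limitin_tau_K_sequentially ..
  then show ?thesis
    by (intro conjI same_convergent_sequences_imp_same_semigroups)
       (simp_all add: topspace_tau_M topspace_tau_K)
qed

end
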